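(* Let $p$ be a prime and let $f(x)=a_{n_r}x^{n_r}+a_{n_{r-1}}x^{n_{r-1}}+\cdots+a_{n_1}x^{n_1}+p^u\epsilon\in \mathcal{S}_1\cup \mathcal{S}_2'\cup \mathcal{S}_3'$ be reducible over $\mathbb{Z}$, with $|a_{n_r}|+|a_{n_{r-1}}|+\cdots+|a_{n_1}|=p^u$. Then $f(x)=f_c(x)f_n(x)$, where $f_n(x)$ is the irreducible non-reciprocal factor of $f(x)$ (so $f_n$ is irreducible over $\mathbb{Z}$ and non-reciprocal) and $$f_c(x)=\gcd\bigl(x^{n_1}+\operatorname{sgn}(a_{n_1}\epsilon),\ldots,x^{n_r}+\operatorname{sgn}(a_{n_r}\epsilon)\bigr).$$
   Context: Let $p$ be a prime number. For a positive integer $n_1$, $\mathcal{S}_{n_1}$ denotes the set of all polynomials $a_{n_r}x^{n_r}+a_{n_{r-1}}x^{n_{r-1}}+\cdots+a_{n_1}x^{n_1}+p^u\epsilon\in\mathbb{Z}[x]$ (with $r\ge 1$) such that $n_r>n_{r-1}>\cdots>n_1>0$ are integers, $u\ge 2$ is an integer, $\epsilon=\pm 1$, $p\nmid a_{n_1}a_{n_r}$, and every $a_{n_i}$ is a nonzero integer. Thus $n_1$ is the smallest positive exponent occurring. Also $\mathcal{S}_{n_1}'=\{f\in\mathcal{S}_{n_1}\mid u\not\equiv 0\pmod{n_1}\}$. For a polynomial $g$, put $\tilde g(x)=x^{\deg(g)}g(x^{-1})$; $g$ is called reciprocal if $g(x)=\pm\tilde g(x)$, and non-reciprocal otherwise.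 $\operatorname{sgn}(x)$ is the sign of the real number $x$, and the gcd of polynomials is the monic one. *)

theory Defs
  imports "HOL-Computational_Algebra.Computational_Algebra"
begin

(* Only the values of the exponents n and of the coefficients a at 1, ..., r matter. *)
definition is_rep ::
  "nat \<Rightarrow> nat \<Rightarrow> (nat \<Rightarrow> nat) \<Rightarrow> (nat \<Rightarrow> int) \<Rightarrow> nat \<Rightarrow> int \<Rightarrow> int poly \<Rightarrow> bool" where
  "is_rep p r n a u \<epsilon> f \<longleftrightarrow>
     r \<ge> 1 \<and> strict_mono_on {1..r} n \<and> n 1 > 0 \<and>
     u \<ge> 2 \<and> (\<epsilon> = 1 \<or> \<epsilon> = -1) \<and>
     (\<forall>i\<in>{1..r}. a i \<noteq> 0) \<and> \<not> int p dvd a 1 * a r \<and>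
     f = (\<Sum>i=1..r. monom (a i) (n i)) + [:int p ^ u * \<epsilon>:]"

definition S :: "nat \<Rightarrow> nat \<Rightarrow> int poly set" where
  "S p m = {f. \<exists>r n a u \<epsilon>. is_rep p r n a u \<epsilon> f \<and> n 1 = m}"

definition S' :: "nat \<Rightarrow> nat \<Rightarrow> int poly set" where
  "S' p m = {f. \<exists>r n a u \<epsilon>. is_rep p r n a u \<epsilon> f \<and> n 1 = m \<and> u mod m \<noteq> 0}"

(* reflect_poly g is x^(deg g) * g(1/x). *)
definition reciprocal :: "int poly \<Rightarrow> bool" where
  "reciprocal g \<longleftrightarrow> g = reflect_poly g \<or> g = - reflect_poly g"

(* Reducible in the ring Z[x], whose only units are 1 and -1. *)
definition reducible :: "int poly \<Rightarrow> bool" where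
  "reducible f \<longleftrightarrow> f \<noteq> 0 \<and> \<not> is_unit f \<and> \<not> irreducible f"

(* Gcd on int poly is normalised to a nonnegative leading coefficient. The polynomials below are
   monic, so their Gcd is monic as well and coincides with the monic gcd over the rationals. *)
definition f_c :: "nat \<Rightarrow> (nat \<Rightarrow> nat) \<Rightarrow> (nat \<Rightarrow> int) \<Rightarrow> int \<Rightarrow> int poly" where
  "f_c r n a \<epsilon> = Gcd ((\<lambda>i. monom 1 (n i) + [:sgn (a i * \<epsilon>):]) ` {1..r})"

end

theory Submission
  imports Defs
begin

text \<open>
  Write \<open>f\<^sub>c\<close> for the gcd in the theorem. Since \<open>\<Sum>i. \<bar>a\<^sub>i\<bar> = p^u\<close>, a root \<open>z\<close> of \<open>f\<close> in the closed
  unit disc is an equality case of the triangle inequality, which forces every term \<open>a\<^sub>i z^n\<^sub>i\<close> to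
  be \<open>- \<epsilon> \<bar>a\<^sub>i\<bar>\<close> (\<open>root_in_disc_imp_power_eq\<close>). Such roots are thus exactly the roots of \<open>f\<^sub>c\<close>;
  they lie on the unit circle, and they are simple roots of \<open>f\<close>. So \<open>f = f\<^sub>c f\<^sub>n\<close>, where all roots
  of \<open>f\<^sub>n\<close> lie strictly outside the unit disc (\<open>cofactor_roots_outside_disc\<close>).

  Consequently a non-unit divisor of \<open>f\<^sub>n\<close> has a constant term other than \<open>\<plusminus>1\<close>, and this constant
  term, being a divisor of \<open>p^u\<close>, is divisible by \<open>p\<close> (\<open>prime_dvd_constant_term\<close>). A proper
  factorization of \<open>f\<^sub>n\<close> would therefore write \<open>f\<close> as a product of two polynomials with constant
  terms divisible by \<open>p\<close>. The first nonzero coefficient of \<open>f\<close> above the constant one is prime to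
  \<open>p\<close> and belongs to \<open>x^m\<close> with \<open>m \<le> 3\<close>, where \<open>m = 1\<close> or \<open>m\<close> does not divide \<open>u\<close>; comparing
  \<open>p\<close>-adic valuations of the coefficients up to \<open>x^m\<close> rules this out
  (\<open>no_factorization_with_both_constant_terms_divisible\<close>). So \<open>f\<^sub>n\<close> is irreducible.

  Since \<open>f\<^sub>n\<close> has all its roots outside the disc, its leading coefficient is smaller in absolute
  value than its constant term, and it is not reciprocal. An irreducible factor of \<open>f\<^sub>c\<close>, however,
  has its roots on the unit circle, where inversion is complex conjugation, and so it is
  reciprocal (\<open>irreducible_unit_circle_root_imp_reciprocal\<close>). This leaves \<open>\<plusminus>f\<^sub>n\<close> as the only
  irreducible non-reciprocal factors of \<open>f\<close>.
\<close>

section \<open>Evaluating integer polynomials at complex numbers\<close>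

definition zeval :: "int poly \<Rightarrow> complex \<Rightarrow> complex" where
  "zeval f z = poly (map_poly of_int f) z"

lemma zeval_0 [simp]: "zeval 0 z = 0"
  by (simp add: zeval_def)

lemma zeval_1 [simp]: "zeval 1 z = 1"
  by (simp add: zeval_def)

lemma zeval_const [simp]: "zeval [:c:] z = of_int c"
  by (simp add: zeval_def map_poly_pCons)

lemma zeval_monom [simp]: "zeval (monom c k) z = of_int c * z ^ k"
  by (simp add: zeval_def map_poly_monom poly_monom)

lemma zeval_add [simp]: "zeval (f + g) z = zeval f z + zeval g z"
proof -
  have "map_poly complex_of_int (f + g) = map_poly of_int f + map_poly of_int g"
    by (intro poly_eqI) (simp add: coeff_map_poly)
  then show ?thesis by (simp add: zeval_def)
qed

lemma zeval_mult [simp]: "zeval (f * g) z = zeval f z * zeval g z"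
proof -
  have "map_poly complex_of_int (f * g) = map_poly of_int f * map_poly of_int g"
    by (intro poly_eqI) (simp add: coeff_map_poly coeff_mult)
  then show ?thesis by (simp add: zeval_def)
qed

lemma zeval_smult [simp]: "zeval (smult c f) z = of_int c * zeval f z"
  using zeval_mult[of "[:c:]" f z] by simp

lemma zeval_sum [simp]: "zeval (\<Sum>i\<in>A. f i) z = (\<Sum>i\<in>A. zeval (f i) z)"
  by (induction A rule: infinite_finite_induct) auto

lemma pderiv_sum: "pderiv (\<Sum>i\<in>A. f i) = (\<Sum>i\<in>A. pderiv (f i))"
  by (induction A rule: infinite_finite_induct) (auto simp: pderiv_add)

lemma zeval_dvd: "g dvd f \<Longrightarrow> zeval g z = 0 \<Longrightarrow> zeval f z = 0"
  by (elim dvdE) simp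

lemma zeval_prod_mset_eq_0:
  "zeval (\<Prod>\<^sub># A) z = 0 \<Longrightarrow> \<exists>g. g \<in># A \<and> zeval g z = 0"
  by (induction A) auto

lemma zeval_cnj: "zeval f (cnj z) = cnj (zeval f z)"
proof -
  have "map_poly cnj (map_poly of_int f) = map_poly of_int f"
    by (intro poly_eqI) (simp add: coeff_map_poly)
  then show ?thesis by (simp add: zeval_def poly_cnj)
qed

lemma zeval_reflect_poly_unit_circle:
  assumes "norm z = 1" "zeval f z = 0"
  shows "zeval (reflect_poly f) z = 0"
proof -
  have z: "z \<noteq> 0" "inverse z = cnj z"
    using assms(1) by (auto simp: complex_div_cnj[of 1] inverse_eq_divide)
  have "map_poly complex_of_int (reflect_poly f) = reflect_poly (map_poly of_int f)"
    by (intro poly_eqI) (simp add: coeff_map_poly coeff_reflect_poly degree_map_poly)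
  then have "zeval (reflect_poly f) z = z ^ degree f * zeval f (cnj z)"
    using z by (simp add: zeval_def poly_reflect_poly_nz degree_map_poly)
  with assms(2) show ?thesis by (simp add: zeval_cnj)
qed

text \<open>
  The primitive minimal polynomial of an algebraic number: pseudo-division shows that it divides a
  constant multiple of each integer polynomial vanishing there, and being prime of positive degree
  in \<open>\<int>[x]\<close> it does not divide the constant. It turns statements about a common complex root into
  divisibility in \<open>\<int>[x]\<close>.
\<close>

lemma minimal_int_poly_exists:
  assumes "f \<noteq> 0" "zeval f z = 0"
  obtains m where "prime_elem m" "zeval m z = 0" "\<And>h. zeval h z = 0 \<Longrightarrow> m dvd h"
proof -
  define V where "V h \<longleftrightarrow> h \<noteq> 0 \<and> zeval h z = 0" for h
  have "V f" using assms by (simp add: V_def)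
  from ex_has_least_nat[of V, OF this, of degree]
  obtain M where M: "V M" "\<And>h. V h \<Longrightarrow> degree M \<le> degree h" by blast
  from M(1) have "M \<noteq> 0" "zeval M z = 0" by (auto simp: V_def)
  from prime_factorization_exists'[OF \<open>M \<noteq> 0\<close>]
  obtain A where A: "\<And>x. x \<in># A \<Longrightarrow> prime x" "normalize (\<Prod>\<^sub># A) = normalize M" by blast
  have "zeval (\<Prod>\<^sub># A) z = 0"
    using \<open>zeval M z = 0\<close> A(2) by (metis associatedD2 zeval_dvd)
  then obtain m where m: "m \<in># A" "zeval m z = 0" using zeval_prod_mset_eq_0 by blast
  have prime: "prime_elem m" using A(1) m(1) by auto
  have "m dvd M" using A(2) m(1) by (metis associatedD1 dvd_prod_mset dvd_trans)
  then have min: "degree m \<le> degree h" if "V h" for h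
    using M(2)[OF that] \<open>M \<noteq> 0\<close> by (meson dvd_imp_degree_le order_trans)
  have "m \<noteq> 0" using prime by auto
  have deg: "degree m > 0"
  proof (rule ccontr)
    assume "\<not> degree m > 0"
    then obtain c where "m = [:c:]" by (auto elim: degree_eq_zeroE)
    with m(2) \<open>m \<noteq> 0\<close> show False by simp
  qed
  have "m dvd h" if h: "zeval h z = 0" for h
  proof -
    obtain c q where cq: "c \<noteq> 0" "smult c h = m * q + pseudo_mod h m"
      using pseudo_mod(1)[OF \<open>m \<noteq> 0\<close>] by blast
    have "zeval (smult c h) z = zeval (m * q + pseudo_mod h m) z" using cq(2) by simp
    then have "zeval (pseudo_mod h m) z = 0" using h m(2) by simp
    then have "pseudo_mod h m = 0"
      using pseudo_mod(2)[OF \<open>m \<noteq> 0\<close>, of h] min[of "pseudo_mod h m"] unfolding V_def by fastforce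
    with cq(2) have "m dvd [:c:] * h" by simp
    then consider "m dvd [:c:]" | "m dvd h"
      using prime prime_elem_dvd_multD by blast
    then show ?thesis
    proof cases
      case 1
      with cq(1) have "degree m \<le> degree [:c:]" by (intro dvd_imp_degree_le) auto
      with deg show ?thesis by simp
    qed
  qed
  with prime m(2) show ?thesis by (rule that)
qed

text \<open>
  Inversion is conjugation on the unit circle and \<open>g\<close> is real, so \<open>z\<close> is a root of the reflection
  as well. Both are then divisible by the minimal polynomial of \<open>z\<close>, with which \<open>g\<close> is associated.
\<close>

lemma irreducible_unit_circle_root_imp_reciprocal:
  assumes "irreducible g" "zeval g z = 0" "norm z = 1"
  shows "reciprocal g"
proof -
  have "g \<noteq> 0" using assms(1) by auto
  from minimal_int_poly_exists[OF this assms(2)]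
  obtain m where m: "prime_elem m" "\<And>h. zeval h z = 0 \<Longrightarrow> m dvd h" by blast
  have "m dvd g" using m(2) assms(2) by blast
  with assms(1) have "g dvd m" using m(1) irreducibleD' prime_elem_not_unit by blast
  also have "m dvd reflect_poly g"
    using m(2) zeval_reflect_poly_unit_circle[OF assms(3,2)] by blast
  finally obtain q where q: "reflect_poly g = g * q" by (elim dvdE)
  have "q \<noteq> 0" using q \<open>g \<noteq> 0\<close> by auto
  then have "degree (reflect_poly g) = degree g + degree q"
    using q \<open>g \<noteq> 0\<close> by (simp add: degree_mult_eq)
  with degree_reflect_poly_le[of g] have dq: "degree q = 0" by simp
  then obtain c where c: "q = [:c:]" by (auto elim: degree_eq_zeroE)
  have r: "reflect_poly g = smult c g" using q c by simp
  have "lead_coeff g = c * coeff g 0"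
    using arg_cong[OF r, of "\<lambda>h. coeff h 0"] by simp
  moreover have "coeff g 0 = c * lead_coeff g"
    using arg_cong[OF r, of "\<lambda>h. coeff h (degree g)"] by (simp add: coeff_reflect_poly)
  ultimately have "(c * c) * lead_coeff g = 1 * lead_coeff g" by simp
  with \<open>g \<noteq> 0\<close> have "c * c = 1" by (metis leading_coeff_0_iff mult_right_cancel)
  then have "c = 1 \<or> c = -1" using square_eq_1_iff by blast
  with r show ?thesis by (auto simp: reciprocal_def)
qed

section \<open>Polynomials without roots in the closed unit disc\<close>

lemma constant_term_dvd: "g dvd f \<Longrightarrow> coeff g 0 dvd coeff f 0"
  by (auto elim!: dvdE simp: coeff_mult)

text \<open>The constant term is, up to sign, the leading coefficient times the product of the roots.\<close>

lemma norm_lead_coeff_less: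
  fixes P :: "complex poly"
  assumes "degree P > 0" "\<And>z. poly P z = 0 \<Longrightarrow> norm z > 1"
  shows "norm (lead_coeff P) < norm (coeff P 0)"
  using assms
proof (induction "degree P" arbitrary: P rule: less_induct)
  case (less P)
  obtain x where x: "poly P x = 0" using alg_closed_imp_poly_has_root less.prems(1) by blast
  then obtain Q where Q: "P = [:-x, 1:] * Q" using poly_eq_0_iff_dvd by (metis dvdE)
  have "Q \<noteq> 0" using less.prems(1) Q by auto
  then have deg: "degree P = Suc (degree Q)" unfolding Q by (subst degree_mult_eq) auto
  have lc: "lead_coeff P = lead_coeff Q" unfolding Q by (subst lead_coeff_mult) simp
  have c0: "coeff P 0 = - x * coeff Q 0" unfolding Q by (simp add: coeff_mult)
  have x1: "norm x > 1" using less.prems(2) x by blast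
  have le: "norm (lead_coeff Q) \<le> norm (coeff Q 0)"
  proof (cases "degree Q = 0")
    case False
    then show ?thesis
      using less.hyps[of Q] less.prems(2) deg Q by (fastforce intro: less_imp_le)
  qed auto
  have "norm (lead_coeff Q) > 0" using \<open>Q \<noteq> 0\<close> by simp
  then have "1 * norm (coeff Q 0) < norm x * norm (coeff Q 0)"
    using le x1 by (intro mult_strict_right_mono) auto
  with le show ?case by (simp add: lc c0 norm_mult)
qed

lemma abs_lead_coeff_less:
  assumes "degree g > 0" "\<And>z. zeval g z = 0 \<Longrightarrow> norm z > 1"
  shows "\<bar>lead_coeff g\<bar> < \<bar>coeff g 0\<bar>"
proof -
  have "norm (lead_coeff (map_poly complex_of_int g)) < norm (coeff (map_poly complex_of_int g) 0)"
    using assms by (intro norm_lead_coeff_less) (auto simp: degree_map_poly zeval_def)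
  then show ?thesis
    by (simp add: coeff_map_poly degree_map_poly flip: of_int_abs)
qed

text \<open>
  A divisor of \<open>p^u\<close> that is prime to \<open>p\<close> is \<open>\<plusminus>1\<close>. With all roots outside the disc, a constant
  term \<open>\<plusminus>1\<close> would be too small to exceed the leading coefficient, unless \<open>d\<close> is constant and thus
  a unit.
\<close>

lemma prime_dvd_constant_term:
  fixes p :: int
  assumes "prime p" "\<not> is_unit d" "coeff d 0 dvd p ^ u"
    and "\<And>z. zeval d z = 0 \<Longrightarrow> norm z > 1"
  shows "p dvd coeff d 0"
proof (rule ccontr)
  assume "\<not> p dvd coeff d 0"
  then have "coprime (p ^ u) (coeff d 0)"
    using assms(1) by (simp add: prime_imp_coprime)
  then have unit: "is_unit (coeff d 0)"
    using assms(3) by (metis coprime_common_divisor dvd_refl)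
  show False
  proof (cases "degree d = 0")
    case True
    then obtain c where "d = [:c:]" by (auto elim: degree_eq_zeroE)
    with unit assms(2) show False by (simp add: is_unit_const_poly_iff)
  next
    case False
    with abs_lead_coeff_less[of d] assms(4) have "\<bar>lead_coeff d\<bar> < \<bar>coeff d 0\<bar>" by auto
    moreover have "\<bar>lead_coeff d\<bar> \<ge> 1" using False by (intro int_one_le_iff_zero_less[THEN iffD2]) auto
    ultimately show False using unit by simp
  qed
qed

section \<open>The low-order coefficients of a product\<close>

lemma prime_power_exponent_unique:
  fixes p :: int
  assumes "prime p" "\<not> p dvd x" "\<not> p dvd y" "p ^ s * x = p ^ t * y"
  shows "s = t"
proof -
  have "multiplicity p (p ^ s * x) = s"
    by (rule multiplicity_decomposeI[OF refl assms(2)]) (use assms(1) in auto)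
  moreover have "multiplicity p (p ^ s * x) = t"
    by (rule multiplicity_decomposeI[OF assms(4,3)]) (use assms(1) in auto)
  ultimately show ?thesis by simp
qed

lemma prime_power_decompose:
  fixes p :: int
  assumes "prime p" "x \<noteq> 0"
  obtains s y where "x = p ^ s * y" "\<not> p dvd y"
  using multiplicity_decompose'[of x p] assms not_prime_unit by metis

text \<open>
  A Newton polygon argument for a product whose coefficients of \<open>x\<close> and \<open>x\<^sup>2\<close> vanish: the lower
  edge of its polygon is the straight segment from \<open>(0, s + t)\<close> to \<open>(3, 0)\<close>. It is composed of an
  edge of width 1 and height \<open>s\<close> from one factor and an edge of width 2 and height \<open>t\<close> from the
  other, so these have the same slope, which means \<open>t = 2 s\<close>.
\<close>

lemma three_dvd_exponent:
  fixes p :: int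
  assumes p: "prime p" and nd: "\<not> p dvd \<alpha>" "\<not> p dvd \<beta>" "\<not> p dvd g1" "\<not> p dvd h2"
    and h1: "p dvd h1" and s: "s \<ge> 1"
    and c1: "p ^ s * \<alpha> * h1 + g1 * (p ^ t * \<beta>) = 0"
    and c2: "p ^ s * \<alpha> * h2 + g1 * h1 + g2 * (p ^ t * \<beta>) = 0"
  shows "s + t = 3 * s"
proof -
  have p0: "p \<noteq> 0" using p by auto
  have "g1 * \<beta> \<noteq> 0" using nd by auto
  then have "h1 \<noteq> 0" using c1 p0 by auto
  then obtain d k where k: "h1 = p ^ d * k" "\<not> p dvd k"
    using p prime_power_decompose by blast
  have d: "d \<ge> 1" using h1 k by (cases d) auto
  have "p ^ (s + d) * (\<alpha> * k) = p ^ t * (- (g1 * \<beta>))"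
    using c1 unfolding k power_add by (simp add: algebra_simps)
  moreover have "\<not> p dvd \<alpha> * k" "\<not> p dvd - (g1 * \<beta>)"
    using nd k p by (auto simp: prime_dvd_mult_iff)
  ultimately have t: "s + d = t" using p prime_power_exponent_unique by blast
  have "p ^ s * (\<alpha> * h2 + p ^ d * (g2 * \<beta>)) = p ^ d * (- (g1 * k))"
    using c2 unfolding k t[symmetric] power_add by (simp add: algebra_simps)
  moreover have "\<not> p dvd \<alpha> * h2 + p ^ d * (g2 * \<beta>)"
  proof -
    have "p dvd p ^ d * (g2 * \<beta>)" using d by simp
    moreover have "\<not> p dvd \<alpha> * h2" using nd p by (auto simp: prime_dvd_mult_iff)
    ultimately show ?thesis by (simp add: dvd_add_left_iff)
  qed
  moreover have "\<not> p dvd - (g1 * k)"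
    using nd k p by (auto simp: prime_dvd_mult_iff)
  ultimately have "s = d" using p prime_power_exponent_unique by blast
  with t show ?thesis by simp
qed

text \<open>
  The lower edge of the Newton polygon of the product is the segment from \<open>(0, u)\<close> to \<open>(m, 0)\<close>,
  and two factors with constant terms divisible by \<open>p\<close> would split it at an interior lattice
  point. There is none: for \<open>m = 1\<close> because no integer lies strictly between 0 and 1, and
  otherwise because \<open>m\<close> is a prime that does not divide \<open>u\<close>.
\<close>

lemma no_factorization_with_both_constant_terms_divisible:
  fixes p :: int
  assumes p: "prime p"
    and G0: "p dvd coeff G 0" and H0: "p dvd coeff H 0"
    and c0: "coeff (G * H) 0 = p ^ u * e" and e: "\<not> p dvd e"
    and low: "\<And>k. 0 < k \<Longrightarrow> k < m \<Longrightarrow> coeff (G * H) k = 0"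
    and cm: "\<not> p dvd coeff (G * H) m"
    and m: "m = 1 \<or> (m = 2 \<or> m = 3) \<and> u mod m \<noteq> 0"
  shows False
proof -
  define g h where "g = coeff G" and "h = coeff H"
  have c: "coeff (G * H) 0 = g 0 * h 0" "coeff (G * H) 1 = g 0 * h 1 + g 1 * h 0"
    "coeff (G * H) 2 = g 0 * h 2 + g 1 * h 1 + g 2 * h 0"
    "coeff (G * H) 3 = g 0 * h 3 + g 1 * h 2 + g 2 * h 1 + g 3 * h 0"
    by (simp_all add: coeff_mult g_def h_def numeral_2_eq_2 numeral_3_eq_3)
  have p0: "p \<noteq> 0" using p by auto
  have "p ^ u * e \<noteq> 0" using e p0 by auto
  then have nz: "g 0 \<noteq> 0" "h 0 \<noteq> 0" using c0 c(1) by auto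
  obtain s \<alpha> where s: "g 0 = p ^ s * \<alpha>" "\<not> p dvd \<alpha>"
    using p nz(1) prime_power_decompose by blast
  obtain t \<beta> where t: "h 0 = p ^ t * \<beta>" "\<not> p dvd \<beta>"
    using p nz(2) prime_power_decompose by blast
  have pd: "p dvd g 0" "p dvd h 0" using G0 H0 by (auto simp: g_def h_def)
  have st1: "s \<ge> 1" "t \<ge> 1" using pd s t by (cases s; cases t; auto)+
  have "p ^ (s + t) * (\<alpha> * \<beta>) = p ^ u * e"
    using c0 unfolding c(1) s(1) t(1) power_add by (simp add: algebra_simps)
  moreover have "\<not> p dvd \<alpha> * \<beta>" using s t p by (auto simp: prime_dvd_mult_iff)
  ultimately have st: "s + t = u" using p e prime_power_exponent_unique by blast
  from m consider "m = 1" | "m = 2" "u mod 2 \<noteq> 0" | "m = 3" "u mod 3 \<noteq> 0" by auto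
  then show False
  proof cases
    case 1
    then show False using cm c(2) pd by auto
  next
    case 2
    have "\<not> p dvd g 1 * h 1" using cm[unfolded 2(1) c(3)] pd by auto
    then have nd: "\<not> p dvd g 1" "\<not> p dvd h 1" by auto
    have "p ^ s * (\<alpha> * h 1) = p ^ t * (- (g 1 * \<beta>))"
      using low[of 1] 2(1) c(2) s t by (simp add: algebra_simps)
    moreover have "\<not> p dvd \<alpha> * h 1" "\<not> p dvd - (g 1 * \<beta>)"
      using nd s t p by (auto simp: prime_dvd_mult_iff)
    ultimately have "s = t" using p prime_power_exponent_unique by blast
    with st have "u = 2 * s" by simp
    with 2(2) show False by simp
  next
    case 3
    have e1: "g 0 * h 1 + g 1 * h 0 = 0" using low[of 1] 3(1) c(2) by simp
    have e2: "g 0 * h 2 + g 1 * h 1 + g 2 * h 0 = 0" using low[of 2] 3(1) c(3) by simp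
    have e3: "\<not> p dvd g 1 * h 2 + g 2 * h 1"
    proof
      assume "p dvd g 1 * h 2 + g 2 * h 1"
      then have "p dvd (g 1 * h 2 + g 2 * h 1) + (g 0 * h 3 + g 3 * h 0)"
        using pd by simp
      with cm[unfolded 3(1) c(4)] show False by (simp add: algebra_simps)
    qed
    have "g 1 * h 1 = - (g 0 * h 2 + g 2 * h 0)" using e2 by simp
    then have "p dvd g 1 * h 1" using pd by simp
    then consider "p dvd h 1" | "p dvd g 1" using p prime_dvd_multD by blast
    then have "u = 3 * s \<or> u = 3 * t"
    proof cases
      case 1
      then have "\<not> p dvd g 1" "\<not> p dvd h 2" using e3 by auto
      from three_dvd_exponent[OF p s(2) t(2) this 1 st1(1), of t "g 2"]
      show ?thesis using e1 e2 s t st by simp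
    next
      case 2
      then have "\<not> p dvd h 1" "\<not> p dvd g 2" using e3 by auto
      from three_dvd_exponent[OF p t(2) s(2) this 2 st1(2), of s "h 2"]
      show ?thesis using e1 e2 s t st by (simp add: algebra_simps)
    qed
    with 3(2) show False by auto
  qed
qed

lemma is_rep_low_coeffs:
  assumes "is_rep p r n a u \<epsilon> f"
  shows "coeff f 0 = int p ^ u * \<epsilon>" "coeff f (n 1) = a 1"
    and "\<And>k. 0 < k \<Longrightarrow> k < n 1 \<Longrightarrow> coeff f k = 0"
proof -
  have r: "1 \<in> {1..r}" and n: "strict_mono_on {1..r} n" "n 1 > 0"
    and f: "f = (\<Sum>i=1..r. monom (a i) (n i)) + [:int p ^ u * \<epsilon>:]"
    using assms by (auto simp: is_rep_def)
  have gt: "n i > n 1" if "i \<in> {1..r}" "i \<noteq> 1" for i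
    using strict_mono_onD[OF n(1) r that(1)] that by auto
  have ge: "n i \<ge> n 1" if "i \<in> {1..r}" for i
    using gt[OF that] by (cases "i = 1") auto
  have cf: "coeff f k = (\<Sum>i=1..r. if n i = k then a i else 0) + coeff [:int p ^ u * \<epsilon>:] k" for k
    by (simp add: f coeff_sum)
  have "(\<Sum>i=1..r. if n i = 0 then a i else 0) = 0"
    using ge n(2) by (intro sum.neutral) force
  then show "coeff f 0 = int p ^ u * \<epsilon>" by (simp add: cf)
  have "(\<Sum>i=1..r. if n i = k then a i else 0) = 0" if "k < n 1" for k
    using ge that by (intro sum.neutral) force
  then show "coeff f k = 0" if "0 < k" "k < n 1" for k
    using that by (simp add: cf coeff_pCons split: nat.split)
  have "(\<Sum>i=1..r. if n i = n 1 then a i else 0) = (\<Sum>i=1..r. if i = 1 then a i else 0)"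
    using gt by (intro sum.cong) force+
  also have "\<dots> = a 1" using r by simp
  finally show "coeff f (n 1) = a 1"
    using n(2) by (simp add: cf coeff_pCons split: nat.split)
qed

section \<open>The cyclotomic part\<close>

lemma f_c_dvd: "i \<in> {1..r} \<Longrightarrow> f_c r n a \<epsilon> dvd monom 1 (n i) + [:sgn (a i * \<epsilon>):]"
  by (auto simp: f_c_def intro: Gcd_dvd)

lemma f_c_root_imp_norm_1:
  assumes "is_rep p r n a u \<epsilon> f" "zeval (f_c r n a \<epsilon>) z = 0"
  shows "norm z = 1"
proof -
  have r: "1 \<in> {1..r}" "n 1 > 0" and nz: "a 1 * \<epsilon> \<noteq> 0"
    using assms(1) by (auto simp: is_rep_def)
  have "zeval (monom 1 (n 1) + [:sgn (a 1 * \<epsilon>):]) z = 0"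
    using zeval_dvd[OF f_c_dvd[OF r(1)] assms(2)] .
  then have "z ^ n 1 = - of_int (sgn (a 1 * \<epsilon>))" by (simp add: eq_neg_iff_add_eq_0)
  then have "norm z ^ n 1 = 1" using nz by (auto simp: norm_power[symmetric] sgn_if)
  then show ?thesis using r(2) power_eq_imp_eq_base[of "norm z" "n 1" 1] by simp
qed

text \<open>Modulo the gcd each \<open>a\<^sub>i x^n\<^sub>i\<close> is \<open>- \<epsilon> \<bar>a\<^sub>i\<bar>\<close>, and these add up to \<open>- \<epsilon> p^u\<close>.\<close>

lemma f_c_dvd_f:
  assumes "is_rep p r n a u \<epsilon> f" "(\<Sum>i=1..r. \<bar>a i\<bar>) = int p ^ u"
  shows "f_c r n a \<epsilon> dvd f"
proof -
  have e: "\<epsilon> = 1 \<or> \<epsilon> = -1"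
    and f: "f = (\<Sum>i=1..r. monom (a i) (n i)) + [:int p ^ u * \<epsilon>:]"
    using assms(1) by (auto simp: is_rep_def)
  have sg: "x * sgn (x * \<epsilon>) = \<bar>x\<bar> * \<epsilon>" for x
    using e by (auto simp: sgn_if abs_if)
  have const: "(\<Sum>i\<in>A. [:b i:]) = [:\<Sum>i\<in>A. b i:]" for A :: "nat set" and b :: "nat \<Rightarrow> int"
    by (induction A rule: infinite_finite_induct) auto
  have "(\<Sum>i=1..r. smult (a i) (monom 1 (n i) + [:sgn (a i * \<epsilon>):]))
      = (\<Sum>i=1..r. monom (a i) (n i)) + [:\<Sum>i=1..r. \<bar>a i\<bar> * \<epsilon>:]"
    by (simp add: smult_add_right smult_monom sum.distrib sg const)
  also have "\<dots> = f" using assms(2) by (simp add: f sum_distrib_right[symmetric])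
  finally have "f = (\<Sum>i=1..r. smult (a i) (monom 1 (n i) + [:sgn (a i * \<epsilon>):]))" ..
  then show ?thesis using f_c_dvd by (auto intro!: dvd_sum dvd_smult)
qed

text \<open>
  In the closed unit disc the relation \<open>f(z) = 0\<close> is an equality case of the triangle inequality:
  the numbers \<open>w\<^sub>i = - \<epsilon> sgn(a\<^sub>i) z^n\<^sub>i\<close> have norm at most 1 and weighted mean 1, so all equal 1.
\<close>

lemma root_in_disc_imp_power_eq:
  assumes rep: "is_rep p r n a u \<epsilon> f" and sum: "(\<Sum>i=1..r. \<bar>a i\<bar>) = int p ^ u"
    and z: "zeval f z = 0" "norm z \<le> 1" and i: "i \<in> {1..r}"
  shows "z ^ n i = - of_int (sgn (a i * \<epsilon>))"
proof -
  have e: "\<epsilon> = 1 \<or> \<epsilon> = -1" and nz: "\<And>i. i \<in> {1..r} \<Longrightarrow> a i \<noteq> 0"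
    and f: "f = (\<Sum>i=1..r. monom (a i) (n i)) + [:int p ^ u * \<epsilon>:]"
    using rep by (auto simp: is_rep_def)
  define w where "w i = - of_int (sgn (a i * \<epsilon>)) * z ^ n i" for i
  have norm_w: "norm (w i) \<le> 1" for i
    using z(2) by (auto simp: w_def norm_mult norm_power sgn_if power_le_one)
  have aw: "of_int \<bar>a i\<bar> * w i = - of_int \<epsilon> * (of_int (a i) * z ^ n i)" for i
    using e by (auto simp: w_def sgn_if abs_if)
  have "(\<Sum>i=1..r. of_int \<bar>a i\<bar> * w i) = - of_int \<epsilon> * (\<Sum>i=1..r. of_int (a i) * z ^ n i)"
    by (simp only: aw sum_distrib_left)
  also have "(\<Sum>i=1..r. of_int (a i) * z ^ n i) = - of_int (int p ^ u * \<epsilon>)"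
    using z(1) by (simp add: f eq_neg_iff_add_eq_0)
  also have "- of_int \<epsilon> * - of_int (int p ^ u * \<epsilon>) = complex_of_int (int p ^ u)"
    using e by auto
  also have "\<dots> = (\<Sum>i=1..r. of_int \<bar>a i\<bar>)"
    unfolding sum[symmetric] by simp
  finally have "Re (\<Sum>i=1..r. of_int \<bar>a i\<bar> * w i) = Re (\<Sum>i=1..r. of_int \<bar>a i\<bar>)" by simp
  then have "(\<Sum>i=1..r. of_int \<bar>a i\<bar> * (1 - Re (w i))) = 0"
    by (simp add: algebra_simps sum_subtractf)
  moreover have "of_int \<bar>a i\<bar> * (1 - Re (w i)) \<ge> 0" for i
    using norm_w[of i] complex_Re_le_cmod[of "w i"] by (intro mult_nonneg_nonneg) auto
  ultimately have "of_int \<bar>a i\<bar> * (1 - Re (w i)) = 0"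
    using i by (subst (asm) sum_nonneg_eq_0_iff) auto
  then have re: "Re (w i) = 1" using nz[OF i] by simp
  moreover have "(Re (w i))\<^sup>2 + (Im (w i))\<^sup>2 \<le> 1"
    using norm_w[of i] unfolding cmod_power2[symmetric] by (simp add: power_le_one)
  ultimately have "Im (w i) = 0" by simp
  with re have "w i = 1" by (simp add: complex_eq_iff)
  then show ?thesis
    using nz[OF i] e by (auto simp: w_def sgn_if minus_equation_iff[of "z ^ n i" 1] split: if_splits)
qed

text \<open>
  Roots of \<open>f\<close> in the closed disc are roots of the gcd, and they are simple because \<open>z f'(z) = - \<epsilon>
  (\<Sum>i. n\<^sub>i \<bar>a\<^sub>i\<bar>) \<noteq> 0\<close> there; none is left for the cofactor.
\<close>

lemma cofactor_roots_outside_disc: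
  assumes rep: "is_rep p r n a u \<epsilon> f" and sum: "(\<Sum>i=1..r. \<bar>a i\<bar>) = int p ^ u"
    and f_n: "f = f_c r n a \<epsilon> * f_n" and z: "zeval f_n z = 0"
  shows "norm z > 1"
proof (rule ccontr)
  assume "\<not> norm z > 1"
  then have z1: "norm z \<le> 1" by simp
  have r: "1 \<in> {1..r}" and e: "\<epsilon> = 1 \<or> \<epsilon> = -1" and nz: "\<And>i. i \<in> {1..r} \<Longrightarrow> a i \<noteq> 0"
    and f: "f = (\<Sum>i=1..r. monom (a i) (n i)) + [:int p ^ u * \<epsilon>:]"
    and mono: "strict_mono_on {1..r} n" and n1: "n 1 > 0"
    using rep by (auto simp: is_rep_def)
  have npos: "n i > 0" if "i \<in> {1..r}" for i
    using strict_mono_onD[OF mono r that] n1 that by (cases "i = 1") auto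
  have zf: "zeval f z = 0" using z f_n by simp
  note pow = root_in_disc_imp_power_eq[OF rep sum zf z1]
  have fnz: "f_n \<noteq> 0"
  proof
    assume "f_n = 0"
    then have "coeff f (n 1) = 0" using f_n by simp
    then show False using is_rep_low_coeffs(2)[OF rep] nz[OF r] by simp
  qed
  obtain m where m: "zeval m z = 0" "\<And>h. zeval h z = 0 \<Longrightarrow> m dvd h"
    using minimal_int_poly_exists[OF fnz z] by blast
  have "m dvd f_c r n a \<epsilon>"
    unfolding f_c_def using pow by (intro Gcd_greatest) (auto intro!: m(2))
  then have zc: "zeval (f_c r n a \<epsilon>) z = 0" using m(1) zeval_dvd by blast
  have "zeval (pderiv f) z = 0" using z zc by (simp add: f_n pderiv_mult)
  moreover have "pderiv f = (\<Sum>i=1..r. monom (of_nat (n i) * a i) (n i - 1))"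
    by (simp add: f pderiv_add pderiv_sum pderiv_monom pderiv_pCons)
  ultimately have "0 = z * (\<Sum>i=1..r. of_int (of_nat (n i) * a i) * z ^ (n i - 1))" by simp
  also have "\<dots> = (\<Sum>i=1..r. of_int (of_nat (n i) * a i) * z ^ n i)"
    unfolding sum_distrib_left
  proof (intro sum.cong refl)
    fix i assume "i \<in> {1..r}"
    then have "z ^ n i = z * z ^ (n i - 1)" using npos by (metis power_eq_if not_gr_zero)
    then show "z * (of_int (of_nat (n i) * a i) * z ^ (n i - 1))
        = of_int (of_nat (n i) * a i) * z ^ n i" by simp
  qed
  also have "\<dots> = (\<Sum>i=1..r. of_int (- (\<epsilon> * (of_nat (n i) * \<bar>a i\<bar>))))"
  proof (intro sum.cong refl)
    fix i assume "i \<in> {1..r}"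
    from pow[OF this] show "complex_of_int (of_nat (n i) * a i) * z ^ n i
        = of_int (- (\<epsilon> * (of_nat (n i) * \<bar>a i\<bar>)))"
      using e by (auto simp: sgn_if abs_if)
  qed
  also have "\<dots> = of_int (- (\<epsilon> * (\<Sum>i=1..r. of_nat (n i) * \<bar>a i\<bar>)))"
    by (simp only: of_int_sum[symmetric] sum_negf sum_distrib_left)
  finally have "(\<Sum>i=1..r. int (n i) * \<bar>a i\<bar>) = 0" using e by (auto simp only: of_int_0_eq_iff)
  moreover have "int (n i) * \<bar>a i\<bar> > 0" if "i \<in> {1..r}" for i using npos nz that by simp
  then have "(\<Sum>i=1..r. int (n i) * \<bar>a i\<bar>) > 0" using r by (intro sum_pos) auto
  ultimately show False by simp
qed

section \<open>The factorization\<close>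

theorem theorem6:
  fixes p r u :: nat and n :: "nat \<Rightarrow> nat" and a :: "nat \<Rightarrow> int"
    and \<epsilon> :: int and f :: "int poly"
  assumes "prime p"
    and "is_rep p r n a u \<epsilon> f"
    and "f \<in> S p 1 \<union> S' p 2 \<union> S' p 3"
    and "reducible f"
    and "(\<Sum>i=1..r. \<bar>a i\<bar>) = int p ^ u"
  shows "\<exists>f_n. f = f_c r n a \<epsilon> * f_n \<and> irreducible f_n \<and> \<not> reciprocal f_n \<and>
           (\<forall>g. irreducible g \<and> g dvd f \<and> \<not> reciprocal g \<longrightarrow> g = f_n \<or> g = - f_n)"
proof -
  let ?p = "int p" and ?c = "f_c r n a \<epsilon>"
  have p: "prime ?p" using assms(1) by simp
  have r: "1 \<in> {1..r}" and u: "u \<ge> 2" and n1: "n 1 > 0"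
    and e: "\<epsilon> = 1 \<or> \<epsilon> = -1" and a1: "a 1 \<noteq> 0"
    using assms(2) by (auto simp: is_rep_def)
  obtain f_n where f_n: "f = ?c * f_n"
    using f_c_dvd_f[OF assms(2,5)] by (elim dvdE)
  have roots: "norm z > 1" if "zeval d z = 0" "d dvd f_n" for d z
    using cofactor_roots_outside_disc[OF assms(2,5) f_n] zeval_dvd that by blast

  \<comment> \<open>Membership in one of the three sets comes with exponents and coefficients of its own; it
    enters through the low-order coefficients, which depend on \<open>f\<close> alone.\<close>
  obtain m u' e' where m: "m = 1 \<or> (m = 2 \<or> m = 3) \<and> u' mod m \<noteq> 0"
    and e': "e' = 1 \<or> e' = -1" and c0: "coeff f 0 = ?p ^ u' * e'"
    and low: "\<And>k. 0 < k \<Longrightarrow> k < m \<Longrightarrow> coeff f k = 0" and cm: "\<not> ?p dvd coeff f m"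
  proof -
    from assms(3) obtain m r' n' a' u' e' where rep: "is_rep p r' n' a' u' e' f" "n' 1 = m"
      and m: "m = 1 \<or> (m = 2 \<or> m = 3) \<and> u' mod m \<noteq> 0"
      unfolding S_def S'_def by blast
    have "\<not> ?p dvd a' 1" "e' = 1 \<or> e' = -1" using rep(1) by (auto simp: is_rep_def)
    with is_rep_low_coeffs[OF rep(1)] rep(2) m show ?thesis by (intro that[of m u' e']) auto
  qed
  have pe': "\<not> ?p dvd e'" using e' p not_prime_unit by auto

  have const_dvd: "?p dvd coeff d 0" if "d dvd f_n" "\<not> is_unit d" for d
  proof (rule prime_dvd_constant_term[OF p that(2)])
    have "d dvd f" using that(1) f_n by auto
    then have "coeff d 0 dvd coeff f 0" by (rule constant_term_dvd)
    then show "coeff d 0 dvd ?p ^ u'" using c0 e' by auto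
    show "norm z > 1" if "zeval d z = 0" for z using roots that \<open>d dvd f_n\<close> by blast
  qed

  have "?p dvd coeff f_n 0"
  proof -
    have "coeff ?c 0 dvd coeff (monom 1 (n 1) + [:sgn (a 1 * \<epsilon>):]) 0"
      using f_c_dvd[OF r] by (rule constant_term_dvd)
    then have "coeff ?c 0 dvd sgn (a 1 * \<epsilon>)" using n1 by simp
    moreover have "sgn (a 1 * \<epsilon>) dvd 1" using a1 e by (auto simp: sgn_if)
    ultimately have "coeff ?c 0 dvd 1" using dvd_trans by blast
    then have nd: "\<not> ?p dvd coeff ?c 0" using p by (meson dvd_trans not_prime_unit)
    have "coeff ?c 0 * coeff f_n 0 = ?p ^ u * \<epsilon>"
      using is_rep_low_coeffs(1)[OF assms(2)] f_n by (simp add: coeff_mult)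
    moreover have "?p dvd ?p ^ u * \<epsilon>" using u by simp
    ultimately show ?thesis using nd p by (metis prime_dvd_multD)
  qed
  have f0: "f \<noteq> 0" using cm by auto
  have irr: "irreducible f_n"
  proof (rule irreducibleI)
    show "f_n \<noteq> 0" using f0 f_n by auto
    show "\<not> is_unit f_n"
    proof
      assume "is_unit f_n"
      then have "is_unit (coeff f_n 0)" using constant_term_dvd[of f_n 1] by simp
      with \<open>?p dvd coeff f_n 0\<close> p show False by (meson dvd_trans not_prime_unit)
    qed
    show "is_unit g \<or> is_unit h" if gh: "f_n = g * h" for g h
    proof (rule ccontr)
      assume "\<not> (is_unit g \<or> is_unit h)"
      then have d: "?p dvd coeff g 0" "?p dvd coeff h 0" using const_dvd gh by auto
      have f: "f = g * (h * ?c)" using f_n gh by (simp add: algebra_simps)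
      have "?p dvd coeff (h * ?c) 0" using d(2) by (simp add: coeff_mult)
      from no_factorization_with_both_constant_terms_divisible[OF p d(1) this
          c0[unfolded f] pe' low[unfolded f] cm[unfolded f] m]
      show False .
    qed
  qed
  have nonrec: "\<not> reciprocal f_n"
  proof
    assume rec: "reciprocal f_n"
    have "degree f_n > 0"
    proof (rule ccontr)
      assume "\<not> degree f_n > 0"
      then obtain c where c: "f_n = [:c:]" by (auto elim: degree_eq_zeroE)
      with \<open>?p dvd coeff f_n 0\<close> have "?p dvd coeff f m" by (simp add: f_n)
      with cm show False ..
    qed
    then have "\<bar>lead_coeff f_n\<bar> < \<bar>coeff f_n 0\<bar>"
      by (rule abs_lead_coeff_less) (simp add: roots)
    moreover from rec have "coeff f_n 0 = lead_coeff f_n \<or> coeff f_n 0 = - lead_coeff f_n"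
      unfolding reciprocal_def by (metis coeff_0_reflect_poly coeff_minus)
    ultimately show False by auto
  qed
  have "g = f_n \<or> g = - f_n" if g: "irreducible g" "g dvd f" "\<not> reciprocal g" for g
  proof -
    have "prime_elem g" using g(1) by (simp add: irreducible_imp_prime_elem)
    moreover have "\<not> g dvd ?c"
    proof
      assume dvd: "g dvd ?c"
      have "degree g > 0"
      proof (rule ccontr)
        assume "\<not> degree g > 0"
        then obtain c where c: "g = [:c:]" by (auto elim: degree_eq_zeroE)
        have "g dvd monom 1 (n 1) + [:sgn (a 1 * \<epsilon>):]" using dvd f_c_dvd[OF r] dvd_trans by blast
        then have "c dvd coeff (monom 1 (n 1) + [:sgn (a 1 * \<epsilon>):]) (n 1)"
          using c const_poly_dvd_iff by blast
        then have "is_unit c" using n1 by (simp add: coeff_pCons split: nat.splits)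
        with c g(1) show False by (simp add: is_unit_const_poly_iff irreducible_def)
      qed
      then obtain z where z: "zeval g z = 0"
        using alg_closed_imp_poly_has_root[of "map_poly complex_of_int g"]
        by (auto simp: zeval_def degree_map_poly)
      then have "norm z = 1" using f_c_root_imp_norm_1[OF assms(2)] zeval_dvd[OF dvd] by blast
      then show False using irreducible_unit_circle_root_imp_reciprocal g z by blast
    qed
    ultimately have "g dvd f_n" using g(2) f_n prime_elem_dvd_multD by blast
    then obtain q where q: "f_n = g * q" by (elim dvdE)
    then have "is_unit q" using irr g(1) by (metis irreducibleD irreducible_not_unit)
    then obtain c where "q = [:c:]" "c = 1 \<or> c = -1"
      by (auto simp: is_unit_poly_iff abs_eq_iff')
    with q show ?thesis by auto
  qed
  with f_n irr nonrec show ?thesis by blast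
qed

end
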